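(* Assume that $\Omega$ is nonempty and compact, that $\Omega\subseteq\Delta=[-1,1]^n$, and that $q_i(x)>0$ for all $x\in\Omega$ and all $i=1,\dots,m$. Let $\{\psi_k\}_{k\in\mathbb{N}}\subset\mathbb{R}[x]$ be a sequence of polynomials such that $\psi_k(x)\ge\tilde\psi(x)$ for all $x\in\Delta$ and all $k$, and $\lim_{k\to\infty}\int_\Delta|\psi_k(x)-\tilde\psi(x)|\,dx=0$. For $\delta>0$ and $k\in\mathbb{N}$ let $\mathcal{A}(\delta,k)=\{x\in\Omega:\psi_k(x)\le\delta\}$. Then: (i) For any $d>0$ there exists $\delta(d)>0$, depending on $d$, such that $\mathcal{A}(\delta,k)\subset\mathcal{S}_w+d\mathbf{B}$ for any $0<\delta<\delta(d)$ and any $k\in\mathbb{N}$. (ii) For any $d>0$ and any $\delta>0$ with $\mathrm{vol}(\{x\in\Omega:\psi(x)=\delta\})=0$, there exists $k(d,\delta)\in\mathbb{N}$, depending on $d$ and $\delta$, such that $$\mathcal{S}_w\cap\mathrm{cl}\left(\mathrm{int}(\Omega\setminus\mathcal{S}_w)\right)\subset\mathcal{A}(\delta,k)+d\mathbf{B}$$ for any $k>k(d,\delta)$.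
   Context: Let $n,m,r\ge 1$, let $p_1,\dots,p_m,q_1,\dots,q_m,g_1,\dots,g_r\in\mathbb{R}[x]$ be real polynomials in $x=(x_1,\dots,x_n)$, let $\Omega=\{x\in\mathbb{R}^n: g_j(x)\ge 0,\ j=1,\dots,r\}$, and let $f=(f_1,\dots,f_m)$ with $f_i=p_i/q_i$. $\mathrm{vol}$ is Lebesgue measure on $\mathbb{R}^n$, $\mathrm{cl}$ and $\mathrm{int}$ are closure and interior in $\mathbb{R}^n$, and $\mathbf{B}$ is the closed Euclidean unit ball of $\mathbb{R}^n$ centered at the origin. $\mathcal{S}_w$ is the set of weakly efficient points, i.e. the set of $x\in\Omega$ such that $f(y)-f(x)\notin-\mathbb{R}^m_{++}$ for all $y\in\Omega$, where $\mathbb{R}^m_{++}$ is the open positive orthant. The achievement function is $\psi(x)=\sup_{y\in\Omega}\min_{i=1,\dots,m}[f_i(x)-f_i(y)]$. Let $\Sigma^2[x]$ denote the set of sums of squares of real polynomials. For each $i$, $f_i^{\mathrm{lower}}$ and $f_i^{\mathrm{upper}}$ are fixed real numbers such that both $p_i-f_i^{\mathrm{lower}}q_i$ and $f_i^{\mathrm{upper}}q_i-p_i$ can be written in the form $\sigma_0+\sum_{j=1}^r\sigma_jg_j+\sum_{j=1}^n\sigma_{r+j}(1-x_j^2)$ with all $\sigma$'s in $\Sigma^2[x]$. Put $f^{\mathrm{lower}}=\min_if_i^{\mathrm{lower}}$ and $f^{\mathrm{upper}}=\max_if_i^{\mathrm{upper}}$, so that $f^{\mathrm{lower}}\le f_i\le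 f^{\mathrm{upper}}$ on $\Omega$ for all $i$. For $x\in\Delta$, let $\mathbf{K}_x$ be the set of all $(y,z)\in\mathbb{R}^n\times\mathbb{R}$ such that $p_i(x)q_i(y)-p_i(y)q_i(x)-zq_i(x)q_i(y)\ge 0$ for $i=1,\dots,m$, $y\in\Omega$, and $z\in[f^{\mathrm{lower}}-f^{\mathrm{upper}},f^{\mathrm{upper}}-f^{\mathrm{lower}}]$; and $\tilde\psi(x)=\max_{(y,z)\in\mathbf{K}_x}z$. It is understood that $\mathbf{K}_x\ne\emptyset$ for every $x\in\Delta$, so that $\tilde\psi$ is a well-defined real-valued function on $\Delta$. *)

theory Defs
  imports "HOL-Analysis.Analysis" "HOL-Library.Set_Algebras"
begin

text \<open>
  Elements of the polynomial ring in the coordinates of \<open>real ^ 'n\<close> are represented by the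
  functions they induce, as singled out by \<^const>\<open>real_polynomial_function\<close>. Over the infinite
  field of reals this loses nothing: a polynomial is determined by its function, so identities
  between polynomials are identities between functions.
  The numbers of variables, of objectives and of constraints are the cardinalities of the finite
  (hence nonempty) index types \<open>'n\<close>, \<open>'m\<close> and \<open>'r\<close>.
\<close>

definition sos :: "(real ^ 'n \<Rightarrow> real) set" where
  "sos = {s. \<exists>N (h :: nat \<Rightarrow> real ^ 'n \<Rightarrow> real).
     (\<forall>l<N. real_polynomial_function (h l)) \<and> s = (\<lambda>x. \<Sum>l<N. (h l x)\<^sup>2)}"

text \<open>In the following, \<open>\<sigma> j\<close> and \<open>\<tau> j\<close> are the multipliers usually written as one list
  \<open>\<sigma>\<^sub>1, \<dots>, \<sigma>\<^sub>r\<close> and \<open>\<sigma>\<^sub>r\<^sub>+\<^sub>1, \<dots>, \<sigma>\<^sub>r\<^sub>+\<^sub>n\<close>.\<close>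

definition quadratic_module :: "('r::finite \<Rightarrow> real ^ 'n \<Rightarrow> real) \<Rightarrow> (real ^ 'n \<Rightarrow> real) set" where
  "quadratic_module g = {h. \<exists>\<sigma>\<^sub>0\<in>sos. \<exists>\<sigma> \<tau>. (\<forall>j::'r. \<sigma> j \<in> sos) \<and> (\<forall>j::'n. \<tau> j \<in> sos) \<and>
     h = (\<lambda>x. \<sigma>\<^sub>0 x + (\<Sum>j\<in>UNIV. \<sigma> j x * g j x) + (\<Sum>j\<in>UNIV. \<tau> j x * (1 - (x $ j)\<^sup>2)))}"

definition feasible :: "('r::finite \<Rightarrow> real ^ 'n \<Rightarrow> real) \<Rightarrow> (real ^ 'n) set" where
  "feasible g = {x. \<forall>j. g j x \<ge> 0}"

definition Box :: "(real ^ 'n) set" where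
  "Box = {x. \<forall>i. x $ i \<in> {-1..1}}"

definition objective ::
  "('m::finite \<Rightarrow> real ^ 'n \<Rightarrow> real) \<Rightarrow> ('m \<Rightarrow> real ^ 'n \<Rightarrow> real) \<Rightarrow> real ^ 'n \<Rightarrow> real ^ 'm" where
  "objective p q x = (\<chi> i. p i x / q i x)"

definition pos_orthant :: "(real ^ 'm) set" where
  "pos_orthant = {v. \<forall>i. v $ i > 0}"

definition weakly_efficient :: "(real ^ 'n) set \<Rightarrow> (real ^ 'n \<Rightarrow> real ^ 'm) \<Rightarrow> (real ^ 'n) set" where
  "weakly_efficient \<Omega> f = {x\<in>\<Omega>. \<forall>y\<in>\<Omega>. f y - f x \<notin> uminus ` pos_orthant}"

definition achievement :: "(real ^ 'n) set \<Rightarrow> (real ^ 'n \<Rightarrow> real ^ 'm) \<Rightarrow> real ^ 'n \<Rightarrow> real" where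
  "achievement \<Omega> f x = (SUP y\<in>\<Omega>. MIN i. f x $ i - f y $ i)"

text \<open>\<open>lo i\<close> and \<open>up i\<close> are the bounds for the \<open>i\<close>-th objective; the interval for \<open>z\<close> uses
  their overall minimum and maximum.\<close>

definition K_set ::
  "(real ^ 'n) set \<Rightarrow> ('m::finite \<Rightarrow> real ^ 'n \<Rightarrow> real) \<Rightarrow> ('m \<Rightarrow> real ^ 'n \<Rightarrow> real) \<Rightarrow>
   ('m \<Rightarrow> real) \<Rightarrow> ('m \<Rightarrow> real) \<Rightarrow> real ^ 'n \<Rightarrow> ((real ^ 'n) \<times> real) set" where
  "K_set \<Omega> p q lo up x = {(y, z).
     (\<forall>i. p i x * q i y - p i y * q i x - z * q i x * q i y \<ge> 0) \<and> y \<in> \<Omega> \<and>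
     z \<in> {(MIN i. lo i) - (MAX i. up i) .. (MAX i. up i) - (MIN i. lo i)}}"

text \<open>The maximum of \<open>z\<close> over the set above; it is meaningful when that set is nonempty and
  compact.\<close>

definition psi_tilde ::
  "(real ^ 'n) set \<Rightarrow> ('m::finite \<Rightarrow> real ^ 'n \<Rightarrow> real) \<Rightarrow> ('m \<Rightarrow> real ^ 'n \<Rightarrow> real) \<Rightarrow>
   ('m \<Rightarrow> real) \<Rightarrow> ('m \<Rightarrow> real) \<Rightarrow> real ^ 'n \<Rightarrow> real" where
  "psi_tilde \<Omega> p q lo up x = (GREATEST z. z \<in> snd ` K_set \<Omega> p q lo up x)"

definition approx_sublevel ::
  "(real ^ 'n) set \<Rightarrow> (nat \<Rightarrow> real ^ 'n \<Rightarrow> real) \<Rightarrow> real \<Rightarrow> nat \<Rightarrow> (real ^ 'n) set" where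
  "approx_sublevel \<Omega> \<psi> \<delta> k = {x\<in>\<Omega>. \<psi> k x \<le> \<delta>}"

definition enlarge :: "(real ^ 'n) set \<Rightarrow> real \<Rightarrow> (real ^ 'n) set" where
  "enlarge S d = S + (\<lambda>b. d *\<^sub>R b) ` cball 0 1"

end

theory Submission
  imports Defs
begin

text \<open>
  On the feasible set \<open>psi_tilde\<close> agrees with the achievement function \<open>\<psi>\<close>, which is continuous there
  and is at most zero exactly at the weakly efficient points. For (i), the approximants lie above
  \<open>\<psi>\<close>, and \<open>\<psi>\<close> has a positive minimum on the compact set of feasible points away from the weakly
  efficient ones. For (ii), finitely many balls of radius \<open>d/2\<close> cover the set on the left; each of
  them contains a nonempty open set of feasible points where \<open>\<psi>\<close> is bounded by some \<open>a < \<delta>\<close>, and if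
  an approximant exceeded \<open>\<delta>\<close> on all of that set, its \<open>L\<^sup>1\<close> distance to \<open>psi_tilde\<close> could not be
  small. This needs \<open>psi_tilde\<close> to be integrable on the box, since otherwise the integrals would have
  the junk value 0.
\<close>

section \<open>Enlargements, certificates and the box\<close>

lemma mem_enlarge_iff:
  assumes "d > 0"
  shows "x \<in> enlarge S d \<longleftrightarrow> (\<exists>s\<in>S. dist s x \<le> d)"
proof
  assume "x \<in> enlarge S d"
  then obtain s b where "s \<in> S" "norm b \<le> 1" "x = s + d *\<^sub>R b"
    unfolding enlarge_def by (auto elim!: set_plus_elim)
  with assms show "\<exists>s\<in>S. dist s x \<le> d"
    by (intro bexI[of _ s]) (auto simp: dist_norm)
next
  assume "\<exists>s\<in>S. dist s x \<le> d"
  then obtain s where s: "s \<in> S" "dist s x \<le> d" by blast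
  have "x = s + d *\<^sub>R ((1 / d) *\<^sub>R (x - s))" using assms by simp
  moreover have "(1 / d) *\<^sub>R (x - s) \<in> cball 0 1"
    using s assms by (simp add: dist_norm norm_minus_commute divide_simps)
  ultimately show "x \<in> enlarge S d"
    unfolding enlarge_def using s(1) by (metis imageI set_plus_intro)
qed

text \<open>On the box each \<open>1 - (x $ j)\<^sup>2\<close> is nonnegative, and so is every
  summand of the representation. This turns the certificates for \<open>lo\<close> and
  \<open>up\<close> into pointwise bounds on the objectives.\<close>

lemma quadratic_module_nonneg:
  assumes "h \<in> quadratic_module g" "x \<in> feasible g" "x \<in> Box"
  shows "h x \<ge> 0"
proof -
  have sos_nonneg: "s x \<ge> 0" if "s \<in> sos" for s
    using that by (auto simp: sos_def intro!: sum_nonneg)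
  have "1 - (x $ j)\<^sup>2 \<ge> 0" for j
    using assms(3) by (simp add: Box_def abs_square_le_1 abs_le_iff minus_le_iff)
  with assms show ?thesis
    by (auto simp: quadratic_module_def feasible_def
        intro!: add_nonneg_nonneg sum_nonneg mult_nonneg_nonneg intro: sos_nonneg)
qed

lemma Box_eq_cbox: "(Box :: (real ^ 'n) set) = cbox (\<chi> i. - 1) (\<chi> i. 1)"
  by (auto simp: Box_def mem_box_cart)

lemma compact_Box: "compact (Box :: (real ^ 'n) set)"
  by (simp add: Box_eq_cbox)

section \<open>The achievement function and weak efficiency\<close>

lemma MIN_UNIV_ge_iff: "a \<le> (MIN i. h i) \<longleftrightarrow> (\<forall>i. a \<le> h i)"
  for h :: "'m::finite \<Rightarrow> real"
  by simp

lemma MIN_UNIV_gr_iff: "a < (MIN i. h i) \<longleftrightarrow> (\<forall>i. a < h i)"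
  for h :: "'m::finite \<Rightarrow> real"
  by simp

text \<open>No coordinate moves by more than the Euclidean distance, hence neither does the minimum.
  This Lipschitz bound yields both the attainment of the supremum in \<open>achievement\<close> and
  the continuity of \<open>achievement\<close>.\<close>

lemma MIN_component_diff:
  fixes u v :: "real ^ 'm"
  shows "(MIN i. u $ i - w $ i) \<le> (MIN i. v $ i - w $ i) + dist u v"
proof -
  have "(MIN i. u $ i - w $ i) - dist u v \<le> v $ i - w $ i" for i
  proof -
    have "(MIN i. u $ i - w $ i) \<le> u $ i - w $ i" by simp
    moreover have "u $ i - v $ i \<le> dist u v"
      using component_le_norm_cart[of "u - v" i] by (simp add: dist_norm)
    ultimately show ?thesis by linarith
  qed
  then have "(MIN i. u $ i - w $ i) - dist u v \<le> (MIN i. v $ i - w $ i)"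
    by (simp only: MIN_UNIV_ge_iff) simp
  then show ?thesis by linarith
qed

text \<open>The minimum is Lipschitz in the vector \<open>f y\<close>, hence continuous in
  \<open>y\<close>, and compactness supplies a maximiser. Later arguments use this maximiser in
  place of the \<open>SUP\<close>, so boundedness need not be discussed again.\<close>

lemma achievement_attained:
  fixes f :: "real ^ 'n \<Rightarrow> real ^ 'm"
  assumes "compact \<Omega>" "\<Omega> \<noteq> {}" "continuous_on \<Omega> f"
  obtains y where "y \<in> \<Omega>" "achievement \<Omega> f x = (MIN i. f x $ i - f y $ i)"
    "\<And>y. y \<in> \<Omega> \<Longrightarrow> (MIN i. f x $ i - f y $ i) \<le> achievement \<Omega> f x"
proof -
  have lip: "dist (MIN i. f x $ i - u $ i) (MIN i. f x $ i - v $ i) \<le> dist u v" for u v :: "real ^ 'm"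
    \<comment> \<open>Writing \<open>f x $ i - u $ i\<close> as
      \<open>(- u) $ i - (- f x) $ i\<close> makes the varying vector the minuend.\<close>
    using MIN_component_diff[of "- u" "- f x" "- v"] MIN_component_diff[of "- v" "- f x" "- u"]
    by (simp add: dist_real_def dist_norm norm_minus_commute)
  have "continuous_on UNIV (\<lambda>u. MIN i. f x $ i - u $ i)"
    unfolding continuous_on_iff using lip order.strict_trans1 by blast
  from continuous_on_compose2[OF this assms(3)]
  have "continuous_on \<Omega> (\<lambda>y. MIN i. f x $ i - f y $ i)" by simp
  from continuous_attains_sup[OF assms(1,2) this]
  obtain y where y: "y \<in> \<Omega>" "\<And>y'. y' \<in> \<Omega> \<Longrightarrow> (MIN i. f x $ i - f y' $ i) \<le> (MIN i. f x $ i - f y $ i)"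
    by blast
  then have "achievement \<Omega> f x = (MIN i. f x $ i - f y $ i)"
    unfolding achievement_def by (intro cSup_eq_maximum) auto
  with y that show thesis by metis
qed

text \<open>A maximiser for \<open>x\<close> is a competitor for \<open>x'\<close>, at a loss of at
  most \<open>dist (f x) (f x')\<close>; exchanging the two points gives the other
  inequality.\<close>

lemma dist_achievement_le:
  fixes f :: "real ^ 'n \<Rightarrow> real ^ 'm"
  assumes "compact \<Omega>" "\<Omega> \<noteq> {}" "continuous_on \<Omega> f"
  shows "dist (achievement \<Omega> f x) (achievement \<Omega> f x') \<le> dist (f x) (f x')"
proof -
  have "achievement \<Omega> f x \<le> achievement \<Omega> f x' + dist (f x) (f x')" for x x'
  proof -
    obtain y where y: "y \<in> \<Omega>" "achievement \<Omega> f x = (MIN i. f x $ i - f y $ i)"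
      using achievement_attained[OF assms] by metis
    have "(MIN i. f x' $ i - f y $ i) \<le> achievement \<Omega> f x'"
      using achievement_attained[OF assms] y(1) by metis
    with MIN_component_diff[of "f x" "f y" "f x'"] y(2) show ?thesis by linarith
  qed
  from this[of x x'] this[of x' x] show ?thesis
    by (simp add: dist_real_def dist_commute)
qed

lemma continuous_on_achievement:
  fixes f :: "real ^ 'n \<Rightarrow> real ^ 'm"
  assumes "compact \<Omega>" "\<Omega> \<noteq> {}" "continuous_on \<Omega> f"
  shows "continuous_on \<Omega> (achievement \<Omega> f)"
  unfolding continuous_on_iff
proof (intro ballI allI impI)
  fix x and e :: real
  assume "x \<in> \<Omega>" "e > 0"
  then obtain r where "r > 0" "\<And>x'. x' \<in> \<Omega> \<Longrightarrow> dist x' x < r \<Longrightarrow> dist (f x') (f x) < e"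
    using assms(3) unfolding continuous_on_iff by blast
  then show "\<exists>r>0. \<forall>x'\<in>\<Omega>. dist x' x < r \<longrightarrow> dist (achievement \<Omega> f x') (achievement \<Omega> f x) < e"
    using order.strict_trans1[OF dist_achievement_le[OF assms]] by blast
qed

text \<open>A point \<open>y\<close> improves on \<open>x\<close> in all objectives exactly when the
  minimum for \<open>y\<close> is positive. Since the supremum is attained, it is positive if and
  only if such a \<open>y\<close> exists.\<close>

lemma weakly_efficient_iff_achievement:
  fixes f :: "real ^ 'n \<Rightarrow> real ^ 'm"
  assumes "compact \<Omega>" "\<Omega> \<noteq> {}" "continuous_on \<Omega> f"
  shows "x \<in> weakly_efficient \<Omega> f \<longleftrightarrow> x \<in> \<Omega> \<and> achievement \<Omega> f x \<le> 0"
proof -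
  have neg: "v \<in> uminus ` pos_orthant \<longleftrightarrow> (\<forall>i. v $ i < 0)" for v :: "real ^ 'm"
  proof
    assume "\<forall>i. v $ i < 0"
    then show "v \<in> uminus ` pos_orthant"
      by (intro image_eqI[of _ _ "- v"]) (auto simp: pos_orthant_def)
  qed (auto simp: pos_orthant_def)
  obtain y where "y \<in> \<Omega>" "achievement \<Omega> f x = (MIN i. f x $ i - f y $ i)"
    and "\<And>y. y \<in> \<Omega> \<Longrightarrow> (MIN i. f x $ i - f y $ i) \<le> achievement \<Omega> f x"
    using achievement_attained[OF assms] by metis
  then have "achievement \<Omega> f x > 0 \<longleftrightarrow> (\<exists>y\<in>\<Omega>. (MIN i. f x $ i - f y $ i) > 0)"
    by (metis order.strict_trans2)
  then have "achievement \<Omega> f x > 0 \<longleftrightarrow> (\<exists>y\<in>\<Omega>. f y - f x \<in> uminus ` pos_orthant)"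
    by (simp only: MIN_UNIV_gr_iff neg) simp
  then show ?thesis
    unfolding weakly_efficient_def by (auto simp: not_less simp flip: not_le)
qed

lemma achievement_sublevel_near_weakly_efficient:
  fixes f :: "real ^ 'n \<Rightarrow> real ^ 'm"
  assumes "compact \<Omega>" "\<Omega> \<noteq> {}" "continuous_on \<Omega> f" "d > 0"
  obtains c where "c > 0"
    "\<And>x. x \<in> \<Omega> \<Longrightarrow> achievement \<Omega> f x < c \<Longrightarrow> x \<in> enlarge (weakly_efficient \<Omega> f) d"
proof -
  define S where "S = weakly_efficient \<Omega> f"
  \<comment> \<open>Removing open balls leaves a compact set, and every removed point lies within
    \<open>d\<close> of a weakly efficient one.\<close>
  define C where "C = \<Omega> - (\<Union>s\<in>S. ball s d)"
  have near: "x \<in> enlarge S d" if "x \<in> \<Omega>" "x \<notin> C" for x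
    using that \<open>d > 0\<close> by (force simp: C_def mem_enlarge_iff)
  have "C \<subseteq> \<Omega>" "compact C"
    unfolding C_def using assms(1) by (auto intro!: compact_diff)
  show thesis
  proof (cases "C = {}")
    case True
    \<comment> \<open>Every feasible point is near here, so any positive threshold will do.\<close>
    with near that[of 1] show thesis by (simp add: S_def)
  next
    case False
    have "continuous_on C (achievement \<Omega> f)"
      using continuous_on_achievement[OF assms(1-3)] \<open>C \<subseteq> \<Omega>\<close> by (rule continuous_on_subset)
    from continuous_attains_inf[OF \<open>compact C\<close> False this] obtain x
      where x: "x \<in> C" "\<And>y. y \<in> C \<Longrightarrow> achievement \<Omega> f x \<le> achievement \<Omega> f y" by blast
    have "x \<in> \<Omega>" "x \<notin> S" using x(1) \<open>d > 0\<close> by (auto simp: C_def)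
    then have "achievement \<Omega> f x > 0"
      using weakly_efficient_iff_achievement[OF assms(1-3)] by (auto simp: S_def)
    then show thesis
      using x(2) near by (intro that[of "achievement \<Omega> f x"]) (force simp: S_def not_le[symmetric])+
  qed
qed

section \<open>Maximum, measurability and integrability of \<open>psi_tilde\<close>\<close>

text \<open>A projection of a compact set of triples \<open>(x, y, z)\<close>. When every \<open>K_set\<close> is nonempty, it is the
  superlevel set of \<open>psi_tilde\<close>, which is how measurability of \<open>psi_tilde\<close> is obtained.\<close>

lemma compact_K_set_superlevel:
  fixes p q :: "'m::finite \<Rightarrow> real ^ 'n \<Rightarrow> real"
  assumes "\<And>i. continuous_on UNIV (p i)" "\<And>i. continuous_on UNIV (q i)" "compact \<Omega>" "compact D"
  shows "compact {x\<in>D. \<exists>y z. (y, z) \<in> K_set \<Omega> p q lo up x \<and> z \<ge> a}" (is "compact ?L")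
proof -
  define l where "l = (MIN i. lo i) - (MAX i. up i)"
  define u where "u = (MAX i. up i) - (MIN i. lo i)"
  \<comment> \<open>The lower endpoint \<open>max a l\<close> merges \<open>z \<ge> a\<close> with
    the prescribed range of \<open>z\<close> into one compact interval.\<close>
  define G where "G = (D \<times> \<Omega> \<times> {max a l..u}) \<inter>
    (\<Inter>i. {(x, y, z). p i x * q i y - p i y * q i x - z * q i x * q i y \<ge> 0})"
  have cont: "continuous_on UNIV (\<lambda>w::(real ^ 'n) \<times> (real ^ 'n) \<times> real. h (k w))"
    if "continuous_on UNIV h" "continuous_on UNIV k" for h :: "real ^ 'n \<Rightarrow> real" and k
    using continuous_on_compose2[OF that] by simp
  have "closed {(x, y, z). p i x * q i y - p i y * q i x - z * q i x * q i y \<ge> 0}" for i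
    unfolding case_prod_beta
    by (intro closed_Collect_le continuous_intros cont assms)
  then have "compact G"
    unfolding G_def by (intro compact_Int_closed compact_Times assms closed_INT) auto
  then have "compact (fst ` G)" by (intro compact_continuous_image continuous_intros)
  also have "fst ` G = ?L"
  proof (intro equalityI subsetI)
    fix x assume "x \<in> fst ` G"
    then obtain y z where "(x, y, z) \<in> G" by force
    then have "x \<in> D" "(y, z) \<in> K_set \<Omega> p q lo up x" "z \<ge> a"
      unfolding G_def K_set_def l_def u_def by simp_all
    then show "x \<in> ?L" by blast
  next
    fix x assume "x \<in> ?L"
    then obtain y z where "x \<in> D" "(y, z) \<in> K_set \<Omega> p q lo up x" "z \<ge> a" by blast
    then have "(x, y, z) \<in> G"
      unfolding G_def K_set_def l_def u_def by simp
    then show "x \<in> fst ` G" by (rule rev_image_eqI) simp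
  qed
  finally show ?thesis .
qed

text \<open>\<open>GREATEST\<close> carries information only once a maximum is known to exist.
  \<open>K_set\<close> is cut out of a compact product by closed conditions, so its projection to
  the \<open>z\<close> axis is compact and has one.\<close>

lemma psi_tilde_greatest:
  fixes p q :: "'m::finite \<Rightarrow> real ^ 'n \<Rightarrow> real"
  assumes "\<And>i. continuous_on UNIV (p i)" "\<And>i. continuous_on UNIV (q i)" "compact \<Omega>"
    and "K_set \<Omega> p q lo up x \<noteq> {}"
  shows "psi_tilde \<Omega> p q lo up x \<in> snd ` K_set \<Omega> p q lo up x"
    and "(y, z) \<in> K_set \<Omega> p q lo up x \<Longrightarrow> z \<le> psi_tilde \<Omega> p q lo up x"
proof -
  let ?Z = "snd ` K_set \<Omega> p q lo up x"
  define l where "l = (MIN i. lo i) - (MAX i. up i)"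
  define u where "u = (MAX i. up i) - (MIN i. lo i)"
  have K: "K_set \<Omega> p q lo up x = (\<Omega> \<times> {l..u}) \<inter>
     (\<Inter>i. {(y, z). p i x * q i y - p i y * q i x - z * q i x * q i y \<ge> 0})"
    by (auto simp: K_set_def l_def u_def)
  have cont: "continuous_on UNIV (\<lambda>w::(real ^ 'n) \<times> real. h (fst w))"
    if "continuous_on UNIV h" for h :: "real ^ 'n \<Rightarrow> real"
    using that by (rule continuous_on_compose2) (auto intro: continuous_intros)
  have "closed {(y, z). p i x * q i y - p i y * q i x - z * q i x * q i y \<ge> 0}" for i
    unfolding case_prod_beta
    by (intro closed_Collect_le continuous_intros cont assms)
  then have "compact (K_set \<Omega> p q lo up x)"
    unfolding K by (intro compact_Int_closed compact_Times assms closed_INT) auto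
  then have "compact ?Z" by (intro compact_continuous_image continuous_intros)
  from compact_attains_sup[OF this] assms(4) obtain m where m: "m \<in> ?Z" "\<forall>w\<in>?Z. w \<le> m"
    by blast
  then have "psi_tilde \<Omega> p q lo up x = m"
    unfolding psi_tilde_def by (intro Greatest_equality) auto
  with m show "psi_tilde \<Omega> p q lo up x \<in> ?Z"
    and "(y, z) \<in> K_set \<Omega> p q lo up x \<Longrightarrow> z \<le> psi_tilde \<Omega> p q lo up x"
    by force+
qed

text \<open>Compact superlevel sets make the function measurable without any claim of continuity off
  the feasible set; the fixed range of \<open>z\<close> bounds it, and \<open>D\<close> has finite
  measure.\<close>

lemma psi_tilde_integrable:
  fixes p q :: "'m::finite \<Rightarrow> real ^ 'n \<Rightarrow> real"
  assumes "\<And>i. continuous_on UNIV (p i)" "\<And>i. continuous_on UNIV (q i)" "compact \<Omega>" "compact D"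
    and ne: "\<And>x. x \<in> D \<Longrightarrow> K_set \<Omega> p q lo up x \<noteq> {}"
  shows "set_integrable lebesgue D (psi_tilde \<Omega> p q lo up)"
proof -
  let ?h = "psi_tilde \<Omega> p q lo up"
  note greatest = psi_tilde_greatest[OF assms(1-3) ne]
  have D: "D \<in> lmeasurable" using \<open>compact D\<close> by (rule lmeasurable_compact)
  \<comment> \<open>Because the maximum is attained, \<open>?h x \<ge> a\<close> is the same as the
    existence of an admissible \<open>z \<ge> a\<close>.\<close>
  have "{x\<in>D. ?h x \<ge> a} = {x\<in>D. \<exists>y z. (y, z) \<in> K_set \<Omega> p q lo up x \<and> z \<ge> a}" for a
    using greatest by (fastforce intro: order_trans)
  then have superlevel: "{x\<in>D. ?h x \<ge> a} \<in> sets lebesgue" for a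
    using fmeasurableD[OF lmeasurable_compact[OF compact_K_set_superlevel[OF assms(1-4)]]] by simp
  have meas: "?h \<in> borel_measurable (lebesgue_on D)"
    unfolding borel_measurable_iff_ge using D superlevel
    by (simp add: sets_restrict_space_iff fmeasurableD)
  \<comment> \<open>The range of \<open>z\<close> is symmetric about 0, so the absolute value of its
    upper endpoint bounds every admissible \<open>z\<close>.\<close>
  define c where "c = \<bar>(MAX i. up i) - (MIN i. lo i)\<bar>"
  have "norm (?h x) \<le> c" if "x \<in> D" for x
    using greatest(1)[OF that] by (auto simp: K_set_def c_def)
  then have "integrable (lebesgue_on D) ?h"
    using D by (intro measurable_bounded_by_integrable_imp_lebesgue_integrable[OF meas, where g="\<lambda>_. c"])
      (auto simp: fmeasurableD integrable_const_ivl lmeasurable_iff_integrable integrable_restrict_space)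
  then show ?thesis
    using D by (simp add: integrable_restrict_space set_integrable_def fmeasurableD)
qed

section \<open>Agreement of \<open>psi_tilde\<close> and \<open>achievement\<close> on the feasible
  set\<close>

lemma continuous_on_objective:
  assumes "\<And>i. continuous_on UNIV (p i)" "\<And>i. continuous_on UNIV (q i)"
    and q: "\<And>i y. y \<in> \<Omega> \<Longrightarrow> q i y > 0"
  shows "continuous_on \<Omega> (objective p q)"
  unfolding objective_def
proof (intro continuous_on_vec_lambda continuous_on_divide ballI)
  show "q i x \<noteq> 0" if "x \<in> \<Omega>" for i x using q[OF that, of i] by simp
qed (auto intro: continuous_on_subset assms)

text \<open>Dividing by \<open>q i x * q i y > 0\<close> turns the constraints into
  \<open>z \<le> f x $ i - f y $ i\<close> for all \<open>i\<close>, with \<open>f\<close> the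
  objective. So the best \<open>z\<close> for a given \<open>y\<close> is the minimum of these
  differences, and the prescribed interval is wide enough not to cut it off.\<close>

lemma psi_tilde_eq_achievement:
  fixes p q :: "'m::finite \<Rightarrow> real ^ 'n \<Rightarrow> real"
  assumes "\<And>i. continuous_on UNIV (p i)" "\<And>i. continuous_on UNIV (q i)" "compact \<Omega>"
    and q: "\<And>i y. y \<in> \<Omega> \<Longrightarrow> q i y > 0"
    and lo: "\<And>i y. y \<in> \<Omega> \<Longrightarrow> lo i * q i y \<le> p i y"
    and up: "\<And>i y. y \<in> \<Omega> \<Longrightarrow> p i y \<le> up i * q i y"
    and x: "x \<in> \<Omega>"
  shows "psi_tilde \<Omega> p q lo up x = achievement \<Omega> (objective p q) x"
proof -
  let ?f = "objective p q"
  have "continuous_on \<Omega> ?f"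
    using assms(1,2) q by (rule continuous_on_objective)
  note attained = achievement_attained[OF assms(3) _ this, where x=x]
  define m where "m y = (MIN i. ?f x $ i - ?f y $ i)" for y
  define l where "l = (MIN i. lo i)"
  define u where "u = (MAX i. up i)"
  have ineq: "p i x * q i y - p i y * q i x - z * q i x * q i y \<ge> 0 \<longleftrightarrow> z \<le> ?f x $ i - ?f y $ i"
    if "y \<in> \<Omega>" for y z i
    using q[OF that, of i] q[OF x, of i] by (simp add: objective_def field_simps)
  have f_bounds: "l \<le> ?f y $ i" "?f y $ i \<le> u" if "y \<in> \<Omega>" for y i
  proof -
    have "l \<le> lo i" "up i \<le> u" by (simp_all add: l_def u_def)
    then have "l * q i y \<le> lo i * q i y" "up i * q i y \<le> u * q i y"
      using q[OF that, of i] by (simp_all add: mult_right_mono)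
    then have "l * q i y \<le> p i y" "p i y \<le> u * q i y"
      using lo[OF that, of i] up[OF that, of i] by linarith+
    then show "l \<le> ?f y $ i" "?f y $ i \<le> u"
      using q[OF that, of i] by (simp_all add: objective_def field_simps)
  qed
  have K: "(y, z) \<in> K_set \<Omega> p q lo up x \<longleftrightarrow> y \<in> \<Omega> \<and> z \<le> m y \<and> l - u \<le> z \<and> z \<le> u - l" for y z
    unfolding K_set_def m_def l_def u_def MIN_UNIV_ge_iff mem_Collect_eq case_prod_conv
      atLeastAtMost_iff using ineq by blast
  have m_bounds: "l - u \<le> m y" "m y \<le> u - l" if "y \<in> \<Omega>" for y
  proof -
    show "l - u \<le> m y"
      unfolding m_def MIN_UNIV_ge_iff using f_bounds x that by (meson diff_mono)
    fix i
    \<comment> \<open>Any single component bounds the minimum from above, so an arbitrary index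
      serves.\<close>
    have "m y \<le> ?f x $ undefined - ?f y $ undefined" unfolding m_def by simp
    also have "\<dots> \<le> u - l" using f_bounds x that by (intro diff_mono)
    finally show "m y \<le> u - l" .
  qed
  from x have "\<Omega> \<noteq> {}" by blast
  then obtain y where y: "y \<in> \<Omega>" "achievement \<Omega> ?f x = m y"
    "\<And>y'. y' \<in> \<Omega> \<Longrightarrow> m y' \<le> achievement \<Omega> ?f x"
    using attained[folded m_def] by blast
  have "(y, m y) \<in> K_set \<Omega> p q lo up x" using y(1) m_bounds[OF y(1)] by (simp add: K)
  then have "m y \<in> snd ` K_set \<Omega> p q lo up x" by (rule rev_image_eqI) simp
  moreover have "z \<le> m y" if "(y', z) \<in> K_set \<Omega> p q lo up x" for y' z
    using that y(2) y(3)[of y'] unfolding K by linarith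
  ultimately show ?thesis
    unfolding psi_tilde_def y(2) by (intro Greatest_equality) auto
qed

section \<open>From convergence of integrals to points of the sublevel sets\<close>

text \<open>If \<open>\<phi> k > b\<close> on all of \<open>U\<close>, the gap
  \<open>\<phi> k - \<psi>\<close> is at least \<open>b - a\<close> on a ball fixed in advance, so
  the integral is at least \<open>c\<close>. For late \<open>k\<close> the limit forbids this; no
  pointwise convergence is needed.\<close>

lemma eventually_approximant_le_on_open:
  fixes \<psi> :: "'a::euclidean_space \<Rightarrow> real"
  assumes lim: "(\<lambda>k. LINT x:D|lebesgue. \<bar>\<phi> k x - \<psi> x\<bar>) \<longlonglongrightarrow> 0"
    and int: "\<And>k. set_integrable lebesgue D (\<lambda>x. \<phi> k x - \<psi> x)"
    and U: "open U" "U \<noteq> {}" "U \<subseteq> D" "\<And>x. x \<in> U \<Longrightarrow> \<psi> x \<le> a" and "a < b"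
  shows "eventually (\<lambda>k. \<exists>x\<in>U. \<phi> k x \<le> b) sequentially"
proof -
  obtain x r where r: "r > 0" "ball x r \<subseteq> U"
    using U(1,2) by (meson ex_in_conv open_contains_ball)
  define c where "c = (b - a) * measure lebesgue (ball x r)"
  have "c > 0" using \<open>a < b\<close> r(1) by (simp add: c_def)
  then have "eventually (\<lambda>k. (LINT x:D|lebesgue. \<bar>\<phi> k x - \<psi> x\<bar>) < c) sequentially"
    using lim by (intro order_tendstoD)
  then show ?thesis
  proof (rule eventually_mono[OF _ ccontr])
    fix k
    assume small: "(LINT x:D|lebesgue. \<bar>\<phi> k x - \<psi> x\<bar>) < c" and "\<not> (\<exists>x\<in>U. \<phi> k x \<le> b)"
    then have big: "b - a \<le> \<bar>\<phi> k y - \<psi> y\<bar>" if "y \<in> ball x r" for y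
      using that r(2) U(4) by fastforce
    have "c = (LINT y|lebesgue. indicat_real (ball x r) y * (b - a))"
      by (simp add: c_def)
    also have "\<dots> \<le> (LINT y:D|lebesgue. \<bar>\<phi> k y - \<psi> y\<bar>)"
      unfolding set_lebesgue_integral_def
    proof (rule integral_mono)
      show "integrable lebesgue (\<lambda>y. indicat_real (ball x r) y * (b - a))"
        by (intro integrable_mult_left)
          (simp add: integrable_indicator_iff emeasure_bounded_finite[unfolded infinity_ennreal_def])
      show "integrable lebesgue (\<lambda>y. indicat_real D y *\<^sub>R \<bar>\<phi> k y - \<psi> y\<bar>)"
        using set_integrable_abs[OF int] by (simp add: set_integrable_def)
      show "indicat_real (ball x r) y * (b - a) \<le> indicat_real D y *\<^sub>R \<bar>\<phi> k y - \<psi> y\<bar>" for y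
        using big[of y] r(2) U(3) by (auto simp: indicator_def)
    qed
    finally show False using small by simp
  qed
qed

text \<open>Membership of \<open>T\<close> in \<open>closure W\<close> places an open piece of
  \<open>W\<close> near each \<open>t\<close>, to which the preceding lemma applies. The index it
  yields depends on \<open>t\<close>; a finite cover makes it uniform.\<close>

lemma approximant_sublevel_near:
  fixes \<psi> :: "real ^ 'n \<Rightarrow> real" and \<delta> :: real
  assumes lim: "(\<lambda>k. LINT x:D|lebesgue. \<bar>\<phi> k x - \<psi> x\<bar>) \<longlonglongrightarrow> 0"
    and int: "\<And>k. set_integrable lebesgue D (\<lambda>x. \<phi> k x - \<psi> x)"
    and \<Omega>: "bounded \<Omega>" "\<Omega> \<subseteq> D" "continuous_on \<Omega> \<psi>"
    and W: "open W" "W \<subseteq> \<Omega>"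
    and T: "T \<subseteq> \<Omega> \<inter> closure W" "\<And>x. x \<in> T \<Longrightarrow> \<psi> x < \<delta>"
    and d: "d > 0"
  shows "eventually (\<lambda>k. T \<subseteq> enlarge (approx_sublevel \<Omega> \<phi> \<delta> k) d) sequentially"
proof -
  have near: "eventually (\<lambda>k. \<exists>x\<in>ball t (d/2). x \<in> \<Omega> \<and> \<phi> k x \<le> \<delta>) sequentially" if "t \<in> T" for t
  proof -
    \<comment> \<open>The level \<open>a\<close> leaves the gap \<open>\<delta> - a > 0\<close> that
      the integral estimate requires.\<close>
    obtain a where a: "\<psi> t < a" "a < \<delta>" using dense T(2)[OF \<open>t \<in> T\<close>] by blast
    have "t \<in> \<Omega>" "t \<in> closure W" using that T(1) by auto
    obtain e where e: "e > 0" "\<And>x. x \<in> \<Omega> \<Longrightarrow> dist x t < e \<Longrightarrow> dist (\<psi> x) (\<psi> t) < a - \<psi> t"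
      using \<Omega>(3) \<open>t \<in> \<Omega>\<close> a(1) unfolding continuous_on_iff by (metis diff_gt_0_iff_gt)
    \<comment> \<open>Radius \<open>e\<close> keeps \<open>\<psi>\<close> below \<open>a\<close>,
      and \<open>d/2\<close> keeps \<open>U\<close> within reach of \<open>t\<close>.\<close>
    define U where "U = W \<inter> ball t (min e (d/2))"
    have "open U" using W(1) by (simp add: U_def open_Int)
    moreover have "U \<noteq> {}"
    proof -
      have "min e (d/2) > 0" using e(1) d by simp
      then obtain w where "w \<in> W" "dist w t < min e (d/2)"
        using \<open>t \<in> closure W\<close> unfolding closure_approachable by blast
      then show ?thesis by (auto simp: U_def dist_commute)
    qed
    moreover have "U \<subseteq> D" using W(2) \<Omega>(2) by (auto simp: U_def)
    moreover have "\<psi> x \<le> a" if "x \<in> U" for x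
      using e(2)[of x] that W(2) by (auto simp: U_def dist_commute dist_real_def abs_less_iff)
    ultimately have "eventually (\<lambda>k. \<exists>x\<in>U. \<phi> k x \<le> \<delta>) sequentially"
      using a(2) by (intro eventually_approximant_le_on_open[OF lim int])
    then show ?thesis
      by (rule eventually_mono) (use W(2) in \<open>auto simp: U_def\<close>)
  qed
  \<comment> \<open>\<open>T\<close> need not be closed, so its closure is covered instead; balls
    centred in \<open>T\<close> still suffice, since \<open>T\<close> is dense in its
    closure.\<close>
  have compact: "compact (closure T)"
    using \<Omega>(1) T(1) by (intro compact_closure[THEN iffD2]) (meson bounded_subset le_inf_iff)
  have cover: "closure T \<subseteq> (\<Union>t\<in>T. ball t (d/2))"
  proof
    fix x assume "x \<in> closure T"
    then obtain t where "t \<in> T" "dist t x < d/2"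
      unfolding closure_approachable using half_gt_zero[OF d] by blast
    then show "x \<in> (\<Union>t\<in>T. ball t (d/2))" by auto
  qed
  obtain F where F: "F \<subseteq> T" "finite F" "closure T \<subseteq> (\<Union>t\<in>F. ball t (d/2))"
    by (rule compactE_image[OF compact _ cover]) auto
  have "eventually (\<lambda>k. \<forall>t\<in>F. \<exists>x\<in>ball t (d/2). x \<in> \<Omega> \<and> \<phi> k x \<le> \<delta>) sequentially"
    using F(1) near by (intro eventually_ball_finite[OF F(2)]) auto
  then show ?thesis
  proof (rule eventually_mono, intro subsetI)
    fix k s
    assume *: "\<forall>t\<in>F. \<exists>x\<in>ball t (d/2). x \<in> \<Omega> \<and> \<phi> k x \<le> \<delta>" and "s \<in> T"
    then have "s \<in> (\<Union>t\<in>F. ball t (d/2))" using F(3) closure_subset by blast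
    then obtain t where t: "t \<in> F" "dist t s < d/2" by auto
    obtain x where x: "dist t x < d/2" "x \<in> \<Omega>" "\<phi> k x \<le> \<delta>"
      using bspec[OF * t(1)] unfolding Bex_def mem_ball by blast
    \<comment> \<open>One \<open>d/2\<close> is spent between \<open>s\<close> and the centre
      \<open>t\<close>, the other between \<open>t\<close> and the sublevel point
      \<open>x\<close>.\<close>
    have "dist x s \<le> d" using t(2) x(1) dist_triangle3[of x s t] by linarith
    then show "s \<in> enlarge (approx_sublevel \<Omega> \<phi> \<delta> k) d"
      using x by (auto simp: mem_enlarge_iff[OF d] approx_sublevel_def)
  qed
qed

section \<open>The two inclusions\<close>

theorem corollary4p1:
  fixes p q :: "'m::finite \<Rightarrow> real ^ 'n \<Rightarrow> real"
    and g :: "'r::finite \<Rightarrow> real ^ 'n \<Rightarrow> real"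
    and lo up :: "'m \<Rightarrow> real"
    and \<psi>\<^sub>k :: "nat \<Rightarrow> real ^ 'n \<Rightarrow> real"
    and \<Omega> S\<^sub>w :: "(real ^ 'n) set"
    and \<psi> \<psi>' :: "real ^ 'n \<Rightarrow> real"
    and A :: "real \<Rightarrow> nat \<Rightarrow> (real ^ 'n) set"
  defines "\<Omega> \<equiv> feasible g"
    and "S\<^sub>w \<equiv> weakly_efficient \<Omega> (objective p q)"
    and "\<psi> \<equiv> achievement \<Omega> (objective p q)"
    and "\<psi>' \<equiv> psi_tilde \<Omega> p q lo up"
    and "A \<equiv> approx_sublevel \<Omega> \<psi>\<^sub>k"
  assumes "\<And>i. real_polynomial_function (p i)"
    and "\<And>i. real_polynomial_function (q i)"
    and "\<And>j. real_polynomial_function (g j)"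
    and "\<And>i. (\<lambda>x. p i x - lo i * q i x) \<in> quadratic_module g"
    and "\<And>i. (\<lambda>x. up i * q i x - p i x) \<in> quadratic_module g"
    and "\<And>x. x \<in> Box \<Longrightarrow> K_set \<Omega> p q lo up x \<noteq> {}"
    and "\<Omega> \<noteq> {}" and "compact \<Omega>" and "\<Omega> \<subseteq> Box"
    and "\<And>i x. x \<in> \<Omega> \<Longrightarrow> q i x > 0"
    and "\<And>k. real_polynomial_function (\<psi>\<^sub>k k)"
    and "\<And>k x. x \<in> Box \<Longrightarrow> \<psi>\<^sub>k k x \<ge> \<psi>' x"
    and "(\<lambda>k. LINT x:Box|lebesgue. \<bar>\<psi>\<^sub>k k x - \<psi>' x\<bar>) \<longlonglongrightarrow> 0"
  shows "(\<forall>d>0. \<exists>\<delta>\<^sub>d>0. \<forall>\<delta> k. 0 < \<delta> \<and> \<delta> < \<delta>\<^sub>d \<longrightarrow> A \<delta> k \<subseteq> enlarge S\<^sub>w d) \<and>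
    (\<forall>d>0. \<forall>\<delta>>0. emeasure lebesgue {x\<in>\<Omega>. \<psi> x = \<delta>} = 0 \<longrightarrow>
      (\<exists>k\<^sub>0. \<forall>k>k\<^sub>0. S\<^sub>w \<inter> closure (interior (\<Omega> - S\<^sub>w)) \<subseteq> enlarge (A \<delta> k) d))"
proof -
  let ?f = "objective p q"
  note hyps = assms(6-)
  note lo = hyps(4) and up = hyps(5) and ne = hyps(6) and \<Omega>_ne = hyps(7) and \<Omega>_cpt = hyps(8)
    and \<Omega>_Box = hyps(9) and q_pos = hyps(10) and \<psi>\<^sub>k_poly = hyps(11) and \<psi>\<^sub>k_ge = hyps(12)
    and lim = hyps(13)
  have cont_p: "continuous_on UNIV (p i)" and cont_q: "continuous_on UNIV (q i)" for i
    using hyps(1,2) by (simp_all add: continuous_real_polymonial_function continuous_at_imp_continuous_on)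
  have cont_f: "continuous_on \<Omega> ?f"
    using cont_p cont_q q_pos by (rule continuous_on_objective)
  have cont_\<psi>: "continuous_on \<Omega> \<psi>"
    unfolding \<psi>_def by (rule continuous_on_achievement[OF \<Omega>_cpt \<Omega>_ne cont_f])
  have S\<^sub>w_iff: "x \<in> S\<^sub>w \<longleftrightarrow> x \<in> \<Omega> \<and> \<psi> x \<le> 0" for x
    unfolding S\<^sub>w_def \<psi>_def by (rule weakly_efficient_iff_achievement[OF \<Omega>_cpt \<Omega>_ne cont_f])
  have eq: "\<psi>' x = \<psi> x" if "x \<in> \<Omega>" for x
    unfolding \<psi>'_def \<psi>_def
  proof (rule psi_tilde_eq_achievement[OF cont_p cont_q \<Omega>_cpt q_pos _ _ that])
    fix i y
    assume "y \<in> \<Omega>"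
    then have "y \<in> feasible g" "y \<in> Box" using \<Omega>_Box by (auto simp: \<Omega>_def)
    with quadratic_module_nonneg[OF lo[of i]] quadratic_module_nonneg[OF up[of i]]
    show "lo i * q i y \<le> p i y" "p i y \<le> up i * q i y" by fastforce+
  qed
  have int: "set_integrable lebesgue Box (\<lambda>x. \<psi>\<^sub>k k x - \<psi>' x)" for k
  proof (rule set_integral_diff(1))
    have "continuous_on UNIV (\<psi>\<^sub>k k)"
      using \<psi>\<^sub>k_poly by (simp add: continuous_real_polymonial_function continuous_at_imp_continuous_on)
    then show "set_integrable lebesgue Box (\<psi>\<^sub>k k)"
      unfolding Box_eq_cbox
      by (intro absolutely_integrable_continuous) (rule continuous_on_subset, auto)
    show "set_integrable lebesgue Box \<psi>'"
      unfolding \<psi>'_def by (rule psi_tilde_integrable[OF cont_p cont_q \<Omega>_cpt compact_Box ne])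
  qed
  show ?thesis
  proof (intro conjI allI impI)
    fix d :: real
    assume "d > 0"
    from achievement_sublevel_near_weakly_efficient[OF \<Omega>_cpt \<Omega>_ne cont_f this]
    obtain c where c: "c > 0" "\<And>x. x \<in> \<Omega> \<Longrightarrow> \<psi> x < c \<Longrightarrow> x \<in> enlarge S\<^sub>w d"
      unfolding \<psi>_def S\<^sub>w_def by metis
    have "A \<delta> k \<subseteq> enlarge S\<^sub>w d" if "\<delta> < c" for \<delta> k
    proof
      fix x
      assume "x \<in> A \<delta> k"
      then have x: "x \<in> \<Omega>" "\<psi>\<^sub>k k x \<le> \<delta>" by (auto simp: A_def approx_sublevel_def)
      \<comment> \<open>The chain is
        \<open>\<psi> x = \<psi>' x \<le> \<psi>\<^sub>k k x \<le> \<delta>\<close>; it holds for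
        every \<open>k\<close>, so the threshold depends on \<open>d\<close> alone.\<close>
      with \<psi>\<^sub>k_ge[of x k] eq[of x] \<Omega>_Box have "\<psi> x \<le> \<delta>" by force
      with c(2) x(1) that show "x \<in> enlarge S\<^sub>w d" by simp
    qed
    with c(1) show "\<exists>\<delta>\<^sub>d>0. \<forall>\<delta> k. 0 < \<delta> \<and> \<delta> < \<delta>\<^sub>d \<longrightarrow> A \<delta> k \<subseteq> enlarge S\<^sub>w d" by blast
  next
    fix d \<delta> :: real
    assume "d > 0" "\<delta> > 0"
    let ?W = "interior (\<Omega> - S\<^sub>w)"
    have "eventually (\<lambda>k. S\<^sub>w \<inter> closure ?W \<subseteq> enlarge (A \<delta> k) d) sequentially"
      unfolding A_def
    \<comment> \<open>The limit speaks of \<open>\<psi>'\<close> on the whole box, so the lemma is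
      applied to \<open>\<psi>'\<close>; its continuity and sign on the feasible set are borrowed
      from \<open>\<psi>\<close>.\<close>
    proof (rule approximant_sublevel_near[OF lim int])
      show "bounded \<Omega>" using \<Omega>_cpt by (rule compact_imp_bounded)
      show "continuous_on \<Omega> \<psi>'" using cont_\<psi> eq by (simp cong: continuous_on_cong)
      show "?W \<subseteq> \<Omega>" using interior_subset by blast
      show "S\<^sub>w \<inter> closure ?W \<subseteq> \<Omega> \<inter> closure ?W" using S\<^sub>w_iff by blast
      show "\<psi>' x < \<delta>" if "x \<in> S\<^sub>w \<inter> closure ?W" for x
        using that S\<^sub>w_iff[of x] eq[of x] \<open>\<delta> > 0\<close> by simp
    qed (use \<Omega>_Box \<open>d > 0\<close> in auto)
    then show "\<exists>k\<^sub>0. \<forall>k>k\<^sub>0. S\<^sub>w \<inter> closure ?W \<subseteq> enlarge (A \<delta> k) d"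
      unfolding eventually_sequentially by (meson less_imp_le)
  qed
qed

end
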